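(* Let $X, Y \in \mathrm{FMet}_{\geq 0}$, that is, let $X$ and $Y$ be nonempty finite metric spaces each admitting a nonnegative weighting. Then $$e^{-2d_{GH}(X, Y)} \leq \frac{\mathrm{Mag}(X)}{\mathrm{Mag}(Y)} \leq e^{2d_{GH}(X, Y)},$$ where $\mathrm{Mag}$ denotes magnitude and $d_{GH}$ denotes the Gromov-Hausdorff distance.
   Context: Let $(X,d_X)$ be a nonempty finite metric space. Its zeta matrix is $Z_X = (e^{-d_X(x,y)})_{x,y\in X}$. A weighting on $X$ is a vector $w_X = (w_x)_{x\in X}\in\mathbb{R}^X$ with $Z_X w_X = \mathbf{1}$, where $\mathbf{1}$ is the column vector with all entries $1$. If a weighting exists, the magnitude of $X$ is $\mathrm{Mag}(X)=\sum_{x\in X} w_x$ (this does not depend on the choice of weighting). A weighting is nonnegative if $w_x\ge 0$ for every $x\in X$. Define $\mathrm{FMet}_{\geq 0}$ as the class of all (nonempty) finite metric spaces that have a nonnegative weighting. For subsets $A,B$ of a metric space, the Hausdorff distance $d_H(A,B)$ is the infimum of all $\varepsilon>0$ such that $A$ is contained in the $\varepsilon$-neighborhood of $B$ and $B$ is contained in the $\varepsilon$-neighborhood of $A$. The Gromov-Hausdorff distance $d_{GH}(X,Y)$ is the infimum of the Hausdorff distances $d_H^d(X,Y)$ over all metrics $d$ on the disjoint union $X\sqcup Y$ that restrict to $d_X$ on $X$ and to $d_Y$ on $Y$. *)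

theory Defs
  imports "HOL-Analysis.Analysis"
begin

definition zeta_matrix :: "'a metric \<Rightarrow> 'a \<Rightarrow> 'a \<Rightarrow> real" where
  "zeta_matrix X x y = exp (- mdist X x y)"

text \<open>
  A vector indexed by the points of a space is a function on the ambient type; its values outside
  \<open>mspace X\<close> are irrelevant everywhere below. The definitions from here to \<open>magnitude\<close> are meant for
  finite spaces.
\<close>

definition weighting :: "'a metric \<Rightarrow> ('a \<Rightarrow> real) \<Rightarrow> bool" where
  "weighting X w \<longleftrightarrow> (\<forall>x\<in>mspace X. (\<Sum>y\<in>mspace X. zeta_matrix X x y * w y) = 1)"

definition nonneg_weighting :: "'a metric \<Rightarrow> ('a \<Rightarrow> real) \<Rightarrow> bool" where
  "nonneg_weighting X w \<longleftrightarrow> weighting X w \<and> (\<forall>x\<in>mspace X. 0 \<le> w x)"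

text \<open>The magnitude is unspecified if there is no weighting; see \<open>magnitude_eq\<close> for the
  independence of the choice.\<close>

definition magnitude :: "'a metric \<Rightarrow> real" where
  "magnitude X = (\<Sum>x\<in>mspace X. (SOME w. weighting X w) x)"

definition FMet_nonneg :: "'a metric set" where
  "FMet_nonneg = {X. finite (mspace X) \<and> mspace X \<noteq> {} \<and> (\<exists>w. nonneg_weighting X w)}"

lemma magnitude_eq:
  assumes w: "weighting X w"
  shows "magnitude X = (\<Sum>x\<in>mspace X. w x)"
proof -
  define v where "v = (SOME v. weighting X v)"
  have v: "weighting X v"
    unfolding v_def using w by (metis someI)
  have "(\<Sum>x\<in>mspace X. v x) = (\<Sum>x\<in>mspace X. (\<Sum>y\<in>mspace X. zeta_matrix X x y * w y) * v x)"
    using w by (simp add: weighting_def)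
  also have "\<dots> = (\<Sum>x\<in>mspace X. \<Sum>y\<in>mspace X. zeta_matrix X x y * w y * v x)"
    by (simp add: sum_distrib_right)
  also have "\<dots> = (\<Sum>y\<in>mspace X. \<Sum>x\<in>mspace X. zeta_matrix X x y * w y * v x)"
    by (rule sum.swap)
  also have "\<dots> = (\<Sum>y\<in>mspace X. (\<Sum>x\<in>mspace X. zeta_matrix X y x * v x) * w y)"
    by (simp add: sum_distrib_left zeta_matrix_def mdist_commute mult_ac)
  also have "\<dots> = (\<Sum>y\<in>mspace X. w y)"
    using v by (simp add: weighting_def)
  finally show ?thesis
    by (simp add: magnitude_def v_def)
qed

definition nbhd :: "'a metric \<Rightarrow> 'a set \<Rightarrow> real \<Rightarrow> 'a set" where
  "nbhd Z A \<epsilon> = (\<Union>a\<in>A. mball_of Z a \<epsilon>)"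

text \<open>
  Both infima below are taken in the reals. They are bounded below by 0, and they range over nonempty
  sets when \<open>A\<close> and \<open>B\<close>, respectively \<open>X\<close> and \<open>Y\<close>, are nonempty and finite; otherwise the value
  may be unspecified (there is no value \<open>\<infinity>\<close>).
\<close>

definition hausdorff_distance :: "'a metric \<Rightarrow> 'a set \<Rightarrow> 'a set \<Rightarrow> real" where
  "hausdorff_distance Z A B = Inf {\<epsilon>. 0 < \<epsilon> \<and> A \<subseteq> nbhd Z B \<epsilon> \<and> B \<subseteq> nbhd Z A \<epsilon>}"

definition disjoint_union_metrics :: "'a metric \<Rightarrow> 'b metric \<Rightarrow> ('a + 'b) metric set" where
  "disjoint_union_metrics X Y =
    {Z. mspace Z = mspace X <+> mspace Y \<and>
        (\<forall>x\<in>mspace X. \<forall>x'\<in>mspace X. mdist Z (Inl x) (Inl x') = mdist X x x') \<and>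
        (\<forall>y\<in>mspace Y. \<forall>y'\<in>mspace Y. mdist Z (Inr y) (Inr y') = mdist Y y y')}"

definition gromov_hausdorff_distance :: "'a metric \<Rightarrow> 'b metric \<Rightarrow> real" where
  "gromov_hausdorff_distance X Y =
    (INF Z\<in>disjoint_union_metrics X Y. hausdorff_distance Z (Inl ` mspace X) (Inr ` mspace Y))"

end

theory Submission
  imports Defs
begin

text \<open>
  Fix a metric \<open>Z\<close> on the disjoint union for which the Hausdorff distance is below \<open>\<epsilon>\<close>, with nonnegative
  weightings \<open>w\<close> on \<open>X\<close> and \<open>v\<close> on \<open>Y\<close>. Every \<open>x\<close> is \<open>\<epsilon>\<close>-close to some \<open>y'\<close>, so that the row sum
  \<open>1 = (\<Sum>y. exp (- d y' y) * v y)\<close> is at most \<open>exp \<epsilon> * (\<Sum>y. exp (- d x y) * v y)\<close>. Summation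
  against \<open>w\<close> bounds the magnitude of \<open>X\<close> by \<open>exp \<epsilon>\<close> times the mixed sum of
  \<open>w x * v y * exp (- d x y)\<close>, and the same comparison in the other variable bounds the mixed sum by
  \<open>exp \<epsilon>\<close> times the magnitude of \<open>Y\<close>.
\<close>

text \<open>Entries of the zeta matrix are at most 1, so with nonnegative weights the total weight
  dominates any row sum, which is 1.\<close>

lemma magnitude_pos:
  assumes "X \<in> FMet_nonneg"
  shows "0 < magnitude X"
proof -
  obtain w x where w: "nonneg_weighting X w" and x: "x \<in> mspace X"
    using assms by (auto simp: FMet_nonneg_def)
  have "1 = (\<Sum>y\<in>mspace X. zeta_matrix X x y * w y)"
    using w x by (simp add: nonneg_weighting_def weighting_def)
  also have "\<dots> \<le> (\<Sum>y\<in>mspace X. w y)"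
    using w by (intro sum_mono mult_left_le_one_le) (auto simp: nonneg_weighting_def zeta_matrix_def)
  also have "\<dots> = magnitude X"
    using w by (simp add: nonneg_weighting_def magnitude_eq[of X w])
  finally show ?thesis by simp
qed

text \<open>Moving a point by less than \<open>\<epsilon>\<close> changes each kernel value by a
  factor of at most \<open>exp \<epsilon>\<close>, and the potential of \<open>v\<close> equals 1 at
  every point of \<open>Y\<close>. The embedding \<open>i\<close> stays abstract so that either
  summand can take the role of \<open>Y\<close>.\<close>

lemma weighting_potential_bounds:
  fixes Y :: "'b metric" and Z :: "'c metric"
  assumes v: "nonneg_weighting Y v"
    and i: "i ` mspace Y \<subseteq> mspace Z"
    and iso: "\<And>y y'. y \<in> mspace Y \<Longrightarrow> y' \<in> mspace Y \<Longrightarrow> mdist Z (i y) (i y') = mdist Y y y'"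
    and p: "p \<in> nbhd Z (i ` mspace Y) \<epsilon>"
  shows "1 \<le> exp \<epsilon> * (\<Sum>y\<in>mspace Y. exp (- mdist Z p (i y)) * v y)"
    and "(\<Sum>y\<in>mspace Y. exp (- mdist Z p (i y)) * v y) \<le> exp \<epsilon>"
proof -
  obtain q where q: "q \<in> mspace Y" and pZ: "p \<in> mspace Z" and d: "mdist Z (i q) p < \<epsilon>"
    using p by (auto simp: nbhd_def)
  have lower: "zeta_matrix Y q y * v y \<le> exp \<epsilon> * (exp (- mdist Z p (i y)) * v y)"
    and upper: "exp (- mdist Z p (i y)) * v y \<le> exp \<epsilon> * (zeta_matrix Y q y * v y)"
    if y: "y \<in> mspace Y" for y
  proof -
    have iy: "i y \<in> mspace Z" "i q \<in> mspace Z"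
      using i y q by auto
    have vy: "0 \<le> v y"
      using v y by (simp add: nonneg_weighting_def)
    have "mdist Z p (i y) \<le> \<epsilon> + mdist Y q y"
      using mdist_triangle[of p Z "i q" "i y"] mdist_commute[of Z p "i q"] d pZ iy iso[OF q y]
      by simp
    then have "zeta_matrix Y q y \<le> exp \<epsilon> * exp (- mdist Z p (i y))"
      by (simp add: zeta_matrix_def flip: exp_add)
    from mult_right_mono[OF this vy]
    show "zeta_matrix Y q y * v y \<le> exp \<epsilon> * (exp (- mdist Z p (i y)) * v y)"
      by (simp add: mult.assoc)
    have "mdist Y q y \<le> \<epsilon> + mdist Z p (i y)"
      using mdist_triangle[of "i q" Z p "i y"] d pZ iy iso[OF q y] by simp
    then have "exp (- mdist Z p (i y)) \<le> exp \<epsilon> * zeta_matrix Y q y"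
      by (simp add: zeta_matrix_def flip: exp_add)
    from mult_right_mono[OF this vy]
    show "exp (- mdist Z p (i y)) * v y \<le> exp \<epsilon> * (zeta_matrix Y q y * v y)"
      by (simp add: mult.assoc)
  qed
  have row: "(\<Sum>y\<in>mspace Y. zeta_matrix Y q y * v y) = 1"
    using v q by (simp add: nonneg_weighting_def weighting_def)
  show "1 \<le> exp \<epsilon> * (\<Sum>y\<in>mspace Y. exp (- mdist Z p (i y)) * v y)"
    unfolding row[symmetric] sum_distrib_left by (intro sum_mono lower)
  show "(\<Sum>y\<in>mspace Y. exp (- mdist Z p (i y)) * v y) \<le> exp \<epsilon>"
    \<comment> \<open>The identity function instantiates the index variable that resolution with
      \<open>upper\<close> leaves schematic.\<close>
    using sum_mono[of "mspace Y", OF upper, of "\<lambda>y. y"] by (simp add: row flip: sum_distrib_left)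
qed

text \<open>This is one half of the comparison: the potential bounds are weighted by
  \<open>w\<close> and summed. It will be applied twice, with the two spaces exchanged.\<close>

lemma magnitude_mixed_sum_bounds:
  fixes X :: "'a metric" and Y :: "'b metric" and Z :: "'c metric"
  assumes w: "nonneg_weighting X w" and v: "nonneg_weighting Y v"
    and i: "i ` mspace Y \<subseteq> mspace Z"
    and iso: "\<And>y y'. y \<in> mspace Y \<Longrightarrow> y' \<in> mspace Y \<Longrightarrow> mdist Z (i y) (i y') = mdist Y y y'"
    and near: "j ` mspace X \<subseteq> nbhd Z (i ` mspace Y) \<epsilon>"
  defines "S \<equiv> \<Sum>x\<in>mspace X. \<Sum>y\<in>mspace Y. exp (- mdist Z (j x) (i y)) * v y * w x"
  shows "magnitude X \<le> exp \<epsilon> * S" and "S \<le> exp \<epsilon> * magnitude X"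
proof -
  define P where "P x = (\<Sum>y\<in>mspace Y. exp (- mdist Z (j x) (i y)) * v y)" for x
  have S: "S = (\<Sum>x\<in>mspace X. P x * w x)"
    by (simp add: S_def P_def sum_distrib_right)
  have X: "magnitude X = (\<Sum>x\<in>mspace X. w x)"
    using w by (simp add: nonneg_weighting_def magnitude_eq[of X w])
  have w_nonneg: "0 \<le> w x" if "x \<in> mspace X" for x
    using w that by (simp add: nonneg_weighting_def)
  have P: "1 \<le> exp \<epsilon> * P x" "P x \<le> exp \<epsilon>" if "x \<in> mspace X" for x
    using weighting_potential_bounds[OF v i iso, of "j x" \<epsilon>] near that by (auto simp: P_def)
  have "(\<Sum>x\<in>mspace X. 1 * w x) \<le> (\<Sum>x\<in>mspace X. exp \<epsilon> * P x * w x)"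
    by (intro sum_mono mult_right_mono P w_nonneg)
  then show "magnitude X \<le> exp \<epsilon> * S"
    by (simp add: X S sum_distrib_left mult.assoc)
  have "S \<le> (\<Sum>x\<in>mspace X. exp \<epsilon> * w x)"
    unfolding S by (intro sum_mono mult_right_mono P w_nonneg)
  then show "S \<le> exp \<epsilon> * magnitude X"
    by (simp add: X sum_distrib_left)
qed

text \<open>The mixed sum \<open>S\<close> is symmetric in the two spaces, so both log magnitudes
  lie within \<open>\<epsilon>\<close> of \<open>ln S\<close>. In logarithmic form the bound is
  linear in \<open>\<epsilon>\<close> and passes directly to infima.\<close>

lemma magnitude_ratio_bounds:
  fixes X :: "'a metric" and Y :: "'b metric"
  assumes X: "X \<in> FMet_nonneg" and Y: "Y \<in> FMet_nonneg"
    and Z: "Z \<in> disjoint_union_metrics X Y"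
    and XY: "Inl ` mspace X \<subseteq> nbhd Z (Inr ` mspace Y) \<epsilon>"
    and YX: "Inr ` mspace Y \<subseteq> nbhd Z (Inl ` mspace X) \<epsilon>"
  shows "\<bar>ln (magnitude X / magnitude Y)\<bar> \<le> 2 * \<epsilon>"
proof -
  obtain w v where w: "nonneg_weighting X w" and v: "nonneg_weighting Y v"
    using X Y by (auto simp: FMet_nonneg_def)
  define S where "S = (\<Sum>x\<in>mspace X. \<Sum>y\<in>mspace Y. exp (- mdist Z (Inl x) (Inr y)) * v y * w x)"
  have space: "Inl ` mspace X \<subseteq> mspace Z" "Inr ` mspace Y \<subseteq> mspace Z"
    using Z by (auto simp: disjoint_union_metrics_def)
  have S_X: "magnitude X \<le> exp \<epsilon> * S" "S \<le> exp \<epsilon> * magnitude X"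
    unfolding S_def using magnitude_mixed_sum_bounds[OF w v space(2) _ XY] Z
    by (simp_all add: disjoint_union_metrics_def)
  have "S = (\<Sum>y\<in>mspace Y. \<Sum>x\<in>mspace X. exp (- mdist Z (Inr y) (Inl x)) * w x * v y)"
    unfolding S_def by (subst sum.swap) (simp add: mdist_commute mult_ac)
  then have S_Y: "magnitude Y \<le> exp \<epsilon> * S" "S \<le> exp \<epsilon> * magnitude Y"
    using magnitude_mixed_sum_bounds[OF v w space(1) _ YX] Z
    by (simp_all add: disjoint_union_metrics_def)
  have pos: "0 < magnitude X" "0 < magnitude Y"
    using X Y by (auto intro: magnitude_pos)
  have "0 < exp \<epsilon> * S"
    using pos(1) S_X(1) by (rule less_le_trans)
  then have "0 < S"
    by (simp add: zero_less_mult_iff)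
  have ln_le: "ln a \<le> \<epsilon> + ln b" if "0 < a" "0 < b" "a \<le> exp \<epsilon> * b" for a b :: real
  proof -
    have "ln a \<le> ln (exp \<epsilon> * b)"
      using that by simp
    then show ?thesis
      using that by (simp add: ln_mult)
  qed
  have "ln (magnitude X) \<le> \<epsilon> + ln S" "ln S \<le> \<epsilon> + ln (magnitude X)"
    "ln (magnitude Y) \<le> \<epsilon> + ln S" "ln S \<le> \<epsilon> + ln (magnitude Y)"
    using pos \<open>0 < S\<close> S_X S_Y by (auto intro: ln_le)
  then show ?thesis
    using pos by (simp add: ln_div)
qed

lemma mdist_bounded_on_finite:
  assumes "finite A" "finite B"
  shows "\<exists>D>0. \<forall>x\<in>A. \<forall>y\<in>B. mdist X x y < D"
proof (intro exI conjI ballI)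
  \<comment> \<open>A sum of nonnegative distances bounds each of them; the extra 1 gives
    strictness, and positivity even for empty sets.\<close>
  let ?D = "1 + (\<Sum>x\<in>A. \<Sum>y\<in>B. mdist X x y)"
  show "0 < ?D"
    by (simp add: add_pos_nonneg sum_nonneg)
  fix x y assume "x \<in> A" "y \<in> B"
  then have "mdist X x y \<le> (\<Sum>y\<in>B. mdist X x y)" "(\<Sum>y\<in>B. mdist X x y) \<le> (\<Sum>x\<in>A. \<Sum>y\<in>B. mdist X x y)"
    using assms by (auto intro!: member_le_sum sum_nonneg)
  then show "mdist X x y < ?D" by simp
qed

lemma disjoint_union_metrics_nonempty:
  fixes X :: "'a metric" and Y :: "'b metric"
  assumes "finite (mspace X)" "finite (mspace Y)"
  shows "disjoint_union_metrics X Y \<noteq> {}"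
proof -
  obtain D1 D2 where D1: "D1 > 0" "\<And>x y. x \<in> mspace X \<Longrightarrow> y \<in> mspace X \<Longrightarrow> mdist X x y < D1"
    and D2: "D2 > 0" "\<And>x y. x \<in> mspace Y \<Longrightarrow> y \<in> mspace Y \<Longrightarrow> mdist Y x y < D2"
    using mdist_bounded_on_finite[of "mspace X" "mspace X" X]
      mdist_bounded_on_finite[of "mspace Y" "mspace Y" Y] assms by meson
  \<comment> \<open>All cross distances equal one constant that exceeds both diameters.\<close>
  define d where "d p q = (case (p, q) of (Inl x, Inl x') \<Rightarrow> mdist X x x' | (Inr y, Inr y') \<Rightarrow> mdist Y y y'
      | _ \<Rightarrow> D1 + D2)" for p q
  have d_simps: "d (Inl x) (Inl x') = mdist X x x'" "d (Inr y) (Inr y') = mdist Y y y'"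
    "d (Inl x) (Inr y) = D1 + D2" "d (Inr y) (Inl x) = D1 + D2" for x x' y y'
    by (simp_all add: d_def)
  interpret Metric_space "mspace X <+> mspace Y" d
  proof
    show "0 \<le> d p q" for p q
      using D1(1) D2(1) by (cases p; cases q) (simp_all add: d_simps)
    show "d p q = d q p" for p q
      by (cases p; cases q) (simp_all add: d_simps mdist_commute)
    show "d p q = 0 \<longleftrightarrow> p = q" if "p \<in> mspace X <+> mspace Y" "q \<in> mspace X <+> mspace Y" for p q
      using that D1(1) D2(1) by (auto simp: d_simps)
    show "d p r \<le> d p q + d q r"
      if "p \<in> mspace X <+> mspace Y" "q \<in> mspace X <+> mspace Y" "r \<in> mspace X <+> mspace Y" for p q r
    proof -
      \<comment> \<open>The critical triangles are detours through the other summand, of length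
        \<open>2 * (D1 + D2)\<close>. If \<open>p\<close> and \<open>r\<close> lie in different
        summands, one leg already has length \<open>D1 + D2\<close>.\<close>
      have "mdist X x x' \<le> 2 * D1 + 2 * D2" if "x \<in> mspace X" "x' \<in> mspace X" for x x'
        using D1(2)[OF that] D1(1) D2(1) by linarith
      moreover have "mdist Y y y' \<le> 2 * D1 + 2 * D2" if "y \<in> mspace Y" "y' \<in> mspace Y" for y y'
        using D2(2)[OF that] D1(1) D2(1) by linarith
      ultimately show ?thesis
        using that D1(1) D2(1) by (auto simp: d_simps mdist_triangle)
    qed
  qed
  have "metric (mspace X <+> mspace Y, d) \<in> disjoint_union_metrics X Y"
    by (simp add: disjoint_union_metrics_def d_simps)
  then show ?thesis by blast
qed

text \<open>A radius above all cross distances works, since then any single point of one set is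
  close to the whole other set.\<close>

lemma hausdorff_radius_exists:
  assumes "finite A" "finite B" "A \<noteq> {}" "B \<noteq> {}" "A \<subseteq> mspace Z" "B \<subseteq> mspace Z"
  shows "\<exists>\<epsilon>>0. A \<subseteq> nbhd Z B \<epsilon> \<and> B \<subseteq> nbhd Z A \<epsilon>"
proof -
  obtain D where D: "D > 0" "\<And>x y. x \<in> A \<Longrightarrow> y \<in> B \<Longrightarrow> mdist Z x y < D"
    using mdist_bounded_on_finite[OF assms(1,2)] by meson
  obtain a b where "a \<in> A" "b \<in> B"
    using assms(3,4) by auto
  with D assms have "A \<subseteq> nbhd Z B D" "B \<subseteq> nbhd Z A D"
    by (fastforce simp: nbhd_def mdist_commute)+
  with D(1) show ?thesis by blast
qed

theorem theorem3p1:
  fixes X :: "'a metric" and Y :: "'b metric"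
  assumes "X \<in> FMet_nonneg" and "Y \<in> FMet_nonneg"
  shows "exp (- 2 * gromov_hausdorff_distance X Y) \<le> magnitude X / magnitude Y \<and>
         magnitude X / magnitude Y \<le> exp (2 * gromov_hausdorff_distance X Y)"
proof -
  define r where "r = magnitude X / magnitude Y"
  have fin: "finite (mspace X)" "finite (mspace Y)" "mspace X \<noteq> {}" "mspace Y \<noteq> {}"
    using assms by (auto simp: FMet_nonneg_def)
  \<comment> \<open>The number \<open>\<bar>ln r\<bar> / 2\<close> is a lower bound for every
    admissible radius, hence for the infimum over radii and then for the infimum over metrics; both
    range over nonempty sets.\<close>
  have "\<bar>ln r\<bar> / 2 \<le> hausdorff_distance Z (Inl ` mspace X) (Inr ` mspace Y)"
    if Z: "Z \<in> disjoint_union_metrics X Y" for Z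
    unfolding hausdorff_distance_def
  proof (rule cInf_greatest)
    have "mspace Z = mspace X <+> mspace Y"
      using Z by (simp add: disjoint_union_metrics_def)
    then show "{\<epsilon>. 0 < \<epsilon> \<and> Inl ` mspace X \<subseteq> nbhd Z (Inr ` mspace Y) \<epsilon>
        \<and> Inr ` mspace Y \<subseteq> nbhd Z (Inl ` mspace X) \<epsilon>} \<noteq> {}"
      using hausdorff_radius_exists[of "Inl ` mspace X" "Inr ` mspace Y" Z] fin by auto
  qed (use magnitude_ratio_bounds[OF assms Z] in \<open>auto simp: r_def field_simps\<close>)
  then have "\<bar>ln r\<bar> / 2 \<le> gromov_hausdorff_distance X Y"
    unfolding gromov_hausdorff_distance_def
    by (intro cINF_greatest disjoint_union_metrics_nonempty fin)
  then have "- 2 * gromov_hausdorff_distance X Y \<le> ln r" "ln r \<le> 2 * gromov_hausdorff_distance X Y"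
    by linarith+
  moreover have "r = exp (ln r)"
    using assms by (simp add: r_def magnitude_pos)
  ultimately have "exp (- 2 * gromov_hausdorff_distance X Y) \<le> r"
    "r \<le> exp (2 * gromov_hausdorff_distance X Y)"
    by (metis exp_le_cancel_iff)+
  then show ?thesis by (simp add: r_def)
qed

end
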